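(* Consider the time-of-arrival (TOA) tracking setting described in the context: sensors $\bm{a}_1,\ldots,\bm{a}_m$, true target positions $\bm{x}_1^\star,\ldots,\bm{x}_T^\star\in\mathcal{T}$, noise levels $\sigma_1,\ldots,\sigma_T$ with maximum noise power $\sigma^2=\max_{t\in\{1,\ldots,T\}}\sigma_t^2$, loss functions $f_t$ with least-squares estimates $\hat{\bm{x}}_t\in\arg\min_{\bm{x}\in\mathbb{R}^n}f_t(\bm{x})$, and the constants $c_0,K_1,K_2,\Lambda,\mu,L$. Suppose that for some given $\delta>0$, $$\|\bm{x}_t^\star-\bm{a}_i\|>K_1\sqrt{m}\,\sigma+K_2m\sigma^2+\delta,\quad i=1,\ldots,m;\ t=1,\ldots,T,$$ and $$\kappa:=\frac{\delta}{10m}\cdot\Lambda-(K_1\sqrt{m}\,\sigma+K_2m\sigma^2)-\frac{4c_0\sigma}{5}>0,$$ and that moreover $$\kappa\ge\frac{2(K_1\sqrt{m}\,\sigma+K_2m\sigma^2)+v}{1-\rho},$$ where $v:=\max_{t\in\{1,\ldots,T-1\}}\|\bm{x}_{t+1}^\star-\bm{x}_t^\star\|$ and $\rho:=\left(1-\frac{2\eta\mu L}{\mu+L}\right)^{1/2}\in(0,1)$, with step size $\eta\in(0,2/(\mu+L)]$. Suppose further that the initial point $\bm{x}_0$ satisfies $\|\bm{x}_0-\bm{x}_1^\star\|\le K_1\sqrt{m}\,\sigma+K_2m\sigma^2$. Let $\{\bm{x}_t\}_{t=1}^T$ be generated by online gradient descent, $\bm{x}_t=\bm{x}_{t-1}-\eta\nabla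 f_t(\bm{x}_{t-1})$ for $t=1,\ldots,T$. Then the cumulative target tracking error ${\rm CTTE}(\{\bm{x}_t\}_{t=1}^T):=\sum_{t=1}^T\|\bm{x}_t-\bm{x}_t^\star\|$ satisfies $${\rm CTTE}\left(\{\bm{x}_t\}_{t=1}^T\right)=\mathcal{O}(1+V(T)+N_1(T)+N_2(T)),$$ where $V(T):=\sum_{t=1}^{T-1}\|\bm{x}_{t+1}^\star-\bm{x}_t^\star\|$ is the path length of the target trajectory, $N_1(T):=\sum_{t=1}^T\sigma_t$ is the cumulative noise standard deviation, and $N_2(T):=\sum_{t=1}^T\sigma_t^2$ is the cumulative noise variance.
   Context: $\|\cdot\|$ is the Euclidean norm, $\lambda_{\min}$ is the smallest eigenvalue of a symmetric matrix, and $B(\bar{\bm{x}},r)=\{\bm{x}\in\mathbb{R}^n:\|\bm{x}-\bar{\bm{x}}\|\le r\}$. Setting. $T$ is the time horizon. The known sensor positions $\bm{a}_1,\ldots,\bm{a}_m\in\mathbb{R}^n$ are such that $\{\bm{a}_i-\bm{a}_1\}_{i=2}^m$ spans $\mathbb{R}^n$. The unknown true position of the moving target at time $t$ is $\bm{x}_t^\star\in\mathbb{R}^n$, and the target stays within a fixed compact region $\mathcal{T}\subseteq\mathbb{R}^n$ throughout. The noisy TOA-based range measurements are $r_i^t=\|\bm{x}_t^\star-\bm{a}_i\|+w_i^t$ for $i=1,\ldots,m$ and $t=1,\ldots,T$, where the noise $w_i^t$ is a random variable with mean zero and variance bounded above by $\sigma_t^2$, independent of the noise at other sensors and at other time steps,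 and $|w_i^t|\ll\|\bm{x}_t^\star-\bm{a}_i\|$ for all $i,t$. With $\bm{w}^t=(w_1^t,\ldots,w_m^t)$, $c_0>0$ is a constant such that $\|\bm{w}^t\|\le c_0\sqrt{m}\,\sigma_t$ for $t=1,\ldots,T$. The (non-convex) loss function at time $t$ is $f_t(\bm{x})=\sum_{i=1}^m(\|\bm{x}-\bm{a}_i\|-r_i^t)^2$. It is non-differentiable at the sensor positions, so the gradient update is written in a formal sense. Constants $K_1,K_2,\Lambda$. For a single target position $\bm{x}^\star$ with measurements $r_i=\|\bm{x}^\star-\bm{a}_i\|+w_i$, where $w_i$ has mean zero and variance at most $\sigma^2$, $|w_i|\ll\|\bm{x}^\star-\bm{a}_i\|$ and $\|(w_1,\ldots,w_m)\|\le c_0\sqrt{m}\,\sigma$ (here $\sigma$ is the noise level of this single-position problem), there exist constants $K_1,K_2>0$, determined by $\bm{a}_1,\ldots,\bm{a}_m$ and $\bm{x}^\star$, such that every minimizer $\hat{\bm{x}}$ of $\sum_{i=1}^m(\|\bm{x}-\bm{a}_i\|-r_i)^2$ over $\mathbb{R}^n$ satisfies $\|\hat{\bm{x}}-\bm{x}^\star\|\le K_1\sqrt{m}\,\sigma+K_2m\sigma^2$. Also, for a single target position $\bm{x}^\star$, let $\Lambda=\lambda_{\min}\left(\sum_{i=1}^m\left(\frac{\bm{x}^\star-\bm{a}_i}{\|\bm{x}^\star-\bm{a}_i\|}\right)\left(\frac{\bm{x}^\star-\bm{a}_i}{\|\bm{x}^\star-\bm{a}_i\|}\right)^T\right)$,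 which is positive. Since the target stays in the compact region $\mathcal{T}$ and these quantities depend continuously on $\bm{x}^\star$, there are finite upper bounds on $K_1,K_2$ and a positive lower bound on $\Lambda$ valid for all $t$; in the claim, $K_1,K_2,\Lambda$ denote these uniform bounds, so that $\kappa$ is also uniform in $t$. Constants $\mu,L$. Under the first two displayed conditions of the claim, there exist constants $\mu,L>0$ such that for all $t=1,\ldots,T$ and all $\bm{x},\bm{y}\in B(\hat{\bm{x}}_t,\kappa)$: $f_t(\bm{x})\ge f_t(\bm{y})+\nabla f_t(\bm{y})^T(\bm{x}-\bm{y})+\frac{\mu}{2}\|\bm{x}-\bm{y}\|^2$ and $\|\nabla f_t(\bm{y})-\nabla f_t(\bm{x})\|\le L\|\bm{x}-\bm{y}\|$; $\mu$ and $L$ in the claim are these constants. *)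

theory Defs
  imports "HOL-Probability.Probability"
begin

section \<open>Matrices and gradients\<close>

(* Intended for symmetric real matrices, where this set of eigenvalues is finite and nonempty. *)
definition lambda_min :: "real^'n^'n \<Rightarrow> real" where
  "lambda_min A = Min {k. \<exists>v. v \<noteq> 0 \<and> A *v v = k *\<^sub>R v}"

definition outer :: "real^'n \<Rightarrow> real^'n \<Rightarrow> real^'n^'n" where
  "outer u v = (\<chi> i j. u $ i * v $ j)"

(* The value is unspecified where f is not differentiable, so an update written with
   grad is a formal one at such points. *)
definition grad :: "('a::real_inner \<Rightarrow> real) \<Rightarrow> 'a \<Rightarrow> 'a" where
  "grad f x = (THE D. GDERIV f x :> D)"

lemma grad_eqI:
  assumes "GDERIV f x :> D"
  shows "grad f x = D"
  unfolding grad_def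
proof (rule the_equality[where P = "\<lambda>D. GDERIV f x :> D", OF assms])
  fix D' assume "GDERIV f x :> D'"
  then have "(\<lambda>h. inner h D') = (\<lambda>h. inner h D)"
    using assms unfolding gderiv_def by (rule has_derivative_unique)
  then have "inner (D' - D) D' = inner (D' - D) D" by metis
  then show "D' = D" by (metis inner_diff_right inner_eq_zero_iff right_minus_eq)
qed

definition strongly_convex_smooth_on ::
  "'a::real_inner set \<Rightarrow> ('a \<Rightarrow> real) \<Rightarrow> real \<Rightarrow> real \<Rightarrow> bool" where
  "strongly_convex_smooth_on S f \<mu> L \<longleftrightarrow>
     (\<forall>x\<in>S. \<forall>y\<in>S.
        f x \<ge> f y + grad f y \<bullet> (x - y) + \<mu> / 2 * (norm (x - y))\<^sup>2 \<and>
        norm (grad f y - grad f x) \<le> L * norm (x - y))"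

section \<open>Localization from ranges\<close>

text \<open>Sensors carry the indices \<open>1, \<dots>, m\<close>, time steps the indices \<open>1, \<dots>, T\<close>.\<close>

definition toa_range :: "(nat \<Rightarrow> real^'n) \<Rightarrow> real^'n \<Rightarrow> (nat \<Rightarrow> real) \<Rightarrow> nat \<Rightarrow> real" where
  "toa_range a xstar w i = norm (xstar - a i) + w i"

definition toa_loss :: "nat \<Rightarrow> (nat \<Rightarrow> real^'n) \<Rightarrow> (nat \<Rightarrow> real) \<Rightarrow> real^'n \<Rightarrow> real" where
  "toa_loss m a r x = (\<Sum>i=1..m. (norm (x - a i) - r i)\<^sup>2)"

lemma grad_toa_loss:
  assumes "\<And>i. i \<in> {1..m} \<Longrightarrow> x \<noteq> a i"
  shows "GDERIV (toa_loss m a r) x :> (\<Sum>i=1..m. (2 * (norm (x - a i) - r i)) *\<^sub>R sgn (x - a i))"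
    and "grad (toa_loss m a r) x = (\<Sum>i=1..m. (2 * (norm (x - a i) - r i)) *\<^sub>R sgn (x - a i))"
proof -
  have "((\<lambda>x. (norm (x - a i) - r i)\<^sup>2) has_derivative
      (\<lambda>h. h \<bullet> (2 * (norm (x - a i) - r i)) *\<^sub>R sgn (x - a i))) (at x)"
    if "i \<in> {1..m}" for i
  proof -
    have "((\<lambda>x. norm (x - a i)) has_derivative (\<lambda>h. h \<bullet> sgn (x - a i))) (at x)"
      using has_derivative_compose[OF has_derivative_diff[OF has_derivative_ident has_derivative_const[of "a i"]],
          of norm "\<lambda>h. h \<bullet> sgn (x - a i)" x UNIV] GDERIV_norm[of "x - a i"] assms[OF that]
      by (simp add: gderiv_def)
    from has_derivative_power[OF has_derivative_diff[OF this has_derivative_const[of "r i"]], of 2]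
    show ?thesis by (simp add: algebra_simps)
  qed
  then have "((\<lambda>x. \<Sum>i=1..m. (norm (x - a i) - r i)\<^sup>2) has_derivative
      (\<lambda>h. \<Sum>i=1..m. h \<bullet> (2 * (norm (x - a i) - r i)) *\<^sub>R sgn (x - a i))) (at x)"
    by (intro has_derivative_sum) auto
  then show 1: "GDERIV (toa_loss m a r) x :>
      (\<Sum>i=1..m. (2 * (norm (x - a i) - r i)) *\<^sub>R sgn (x - a i))"
    unfolding gderiv_def toa_loss_def[abs_def] by (simp add: inner_sum_right)
  show "grad (toa_loss m a r) x = (\<Sum>i=1..m. (2 * (norm (x - a i) - r i)) *\<^sub>R sgn (x - a i))"
    by (rule grad_eqI[OF 1])
qed

definition least_squares_estimate ::
  "nat \<Rightarrow> (nat \<Rightarrow> real^'n) \<Rightarrow> (nat \<Rightarrow> real) \<Rightarrow> real^'n \<Rightarrow> bool" where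
  "least_squares_estimate m a r xhat \<longleftrightarrow> is_arg_min (toa_loss m a r) (\<lambda>_. True) xhat"

text \<open>
  The conditions on a realized noise vector. The requirement that each \<open>\<bar>w i\<bar>\<close> be much smaller
  than the true range is rendered with a ratio \<open>\<theta>\<close>, to be taken in the open unit interval.
\<close>

definition noise_bounded ::
  "nat \<Rightarrow> (nat \<Rightarrow> real^'n) \<Rightarrow> real \<Rightarrow> real \<Rightarrow> real^'n \<Rightarrow> real \<Rightarrow> (nat \<Rightarrow> real) \<Rightarrow> bool" where
  "noise_bounded m a \<theta> c0 xstar \<sigma> w \<longleftrightarrow>
     (\<forall>i\<in>{1..m}. \<bar>w i\<bar> \<le> \<theta> * norm (xstar - a i)) \<and>
     L2_set w {1..m} \<le> c0 * sqrt (real m) * \<sigma>"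

definition err_bound :: "nat \<Rightarrow> real \<Rightarrow> real \<Rightarrow> real \<Rightarrow> real" where
  "err_bound m K1 K2 \<sigma> = K1 * sqrt (real m) * \<sigma> + K2 * real m * \<sigma>\<^sup>2"

text \<open>
  \<open>K1\<close> and \<open>K2\<close> are valid estimation error constants at the position \<open>xstar\<close>. The quantifier over
  all noise levels \<open>\<sigma>\<close> reflects that the constants do not depend on the noise. Mean and variance
  of the noise do not restrict an individual realization \<open>w\<close>.
\<close>

definition estimation_error_consts ::
  "nat \<Rightarrow> (nat \<Rightarrow> real^'n) \<Rightarrow> real \<Rightarrow> real \<Rightarrow> real \<Rightarrow> real \<Rightarrow> real^'n \<Rightarrow> bool" where
  "estimation_error_consts m a \<theta> c0 K1 K2 xstar \<longleftrightarrow>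
     (\<forall>\<sigma>\<ge>0. \<forall>w. noise_bounded m a \<theta> c0 xstar \<sigma> w \<longrightarrow>
        (\<forall>xhat. least_squares_estimate m a (toa_range a xstar w) xhat \<longrightarrow>
           norm (xhat - xstar) \<le> err_bound m K1 K2 \<sigma>))"

definition direction_matrix :: "nat \<Rightarrow> (nat \<Rightarrow> real^'n) \<Rightarrow> real^'n \<Rightarrow> real^'n^'n" where
  "direction_matrix m a xstar =
     (\<Sum>i=1..m. outer ((xstar - a i) /\<^sub>R norm (xstar - a i)) ((xstar - a i) /\<^sub>R norm (xstar - a i)))"

section \<open>Tracking\<close>

definition noise_model ::
  "'w measure \<Rightarrow> nat \<Rightarrow> nat \<Rightarrow> (nat \<Rightarrow> real) \<Rightarrow> (nat \<Rightarrow> nat \<Rightarrow> 'w \<Rightarrow> real) \<Rightarrow> bool" where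
  "noise_model M m T \<sigma> w \<longleftrightarrow>
     prob_space M \<and>
     (\<forall>t\<in>{1..T}. \<forall>i\<in>{1..m}.
        integrable M (w t i) \<and> integral\<^sup>L M (w t i) = 0 \<and>
        integrable M (\<lambda>\<omega>. (w t i \<omega>)\<^sup>2) \<and>
        integral\<^sup>L M (\<lambda>\<omega>. (w t i \<omega> - integral\<^sup>L M (w t i))\<^sup>2) \<le> (\<sigma> t)\<^sup>2) \<and>
     prob_space.indep_vars M (\<lambda>_. borel) (\<lambda>(t, i). w t i) ({1..T} \<times> {1..m})"

definition sigma_max :: "nat \<Rightarrow> (nat \<Rightarrow> real) \<Rightarrow> real" where
  "sigma_max T \<sigma> = sqrt (Max ((\<lambda>t. (\<sigma> t)\<^sup>2) ` {1..T}))"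

(* Inserting 0 only matters for T = 1, where the maximum would range over the empty set. *)
definition max_step :: "nat \<Rightarrow> (nat \<Rightarrow> real^'n) \<Rightarrow> real" where
  "max_step T xstar = Max (insert 0 ((\<lambda>t. norm (xstar (t + 1) - xstar t)) ` {1..T - 1}))"

definition kappa :: "nat \<Rightarrow> real \<Rightarrow> real \<Rightarrow> real \<Rightarrow> real \<Rightarrow> real \<Rightarrow> real \<Rightarrow> real" where
  "kappa m c0 K1 K2 \<Lambda> \<delta> \<sigma> = \<delta> / (10 * real m) * \<Lambda> - err_bound m K1 K2 \<sigma> - 4 * c0 * \<sigma> / 5"

definition rho :: "real \<Rightarrow> real \<Rightarrow> real \<Rightarrow> real" where
  "rho \<eta> \<mu> L = sqrt (1 - 2 * \<eta> * \<mu> * L / (\<mu> + L))"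

definition CTTE :: "nat \<Rightarrow> (nat \<Rightarrow> real^'n) \<Rightarrow> (nat \<Rightarrow> real^'n) \<Rightarrow> real" where
  "CTTE T xstar x = (\<Sum>t=1..T. norm (x t - xstar t))"

definition path_length :: "nat \<Rightarrow> (nat \<Rightarrow> real^'n) \<Rightarrow> real" where
  "path_length T xstar = (\<Sum>t=1..T - 1. norm (xstar (t + 1) - xstar t))"

definition cum_noise_std :: "nat \<Rightarrow> (nat \<Rightarrow> real) \<Rightarrow> real" where
  "cum_noise_std T \<sigma> = (\<Sum>t=1..T. \<sigma> t)"

definition cum_noise_var :: "nat \<Rightarrow> (nat \<Rightarrow> real) \<Rightarrow> real" where
  "cum_noise_var T \<sigma> = (\<Sum>t=1..T. (\<sigma> t)\<^sup>2)"

text \<open>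
  The conditions on the target trajectory \<open>xstar\<close> and the noise levels \<open>\<sigma>\<close>.
  \<open>K1\<close>, \<open>K2\<close> and \<open>\<Lambda>\<close> are bounds valid for all positions of the trajectory.
\<close>

definition trajectory_conditions ::
  "nat \<Rightarrow> (nat \<Rightarrow> real^'n) \<Rightarrow> (real^'n) set \<Rightarrow> real \<Rightarrow> real \<Rightarrow> real \<Rightarrow> real \<Rightarrow> real \<Rightarrow> real \<Rightarrow>
   real \<Rightarrow> real \<Rightarrow> real \<Rightarrow> nat \<Rightarrow> (nat \<Rightarrow> real^'n) \<Rightarrow> (nat \<Rightarrow> real) \<Rightarrow> bool" where
  "trajectory_conditions m a Region \<theta> c0 K1 K2 \<Lambda> \<delta> \<eta> \<mu> L T xstar \<sigma> \<longleftrightarrow>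
     (\<forall>t\<in>{1..T}. xstar t \<in> Region \<and> 0 \<le> \<sigma> t \<and>
        estimation_error_consts m a \<theta> c0 K1 K2 (xstar t) \<and>
        \<Lambda> \<le> lambda_min (direction_matrix m a (xstar t)) \<and>
        (\<forall>i\<in>{1..m}. norm (xstar t - a i) > err_bound m K1 K2 (sigma_max T \<sigma>) + \<delta>)) \<and>
     kappa m c0 K1 K2 \<Lambda> \<delta> (sigma_max T \<sigma>) > 0 \<and>
     kappa m c0 K1 K2 \<Lambda> \<delta> (sigma_max T \<sigma>) \<ge>
       (2 * err_bound m K1 K2 (sigma_max T \<sigma>) + max_step T xstar) / (1 - rho \<eta> \<mu> L)"

definition ogd :: "nat \<Rightarrow> real \<Rightarrow> (nat \<Rightarrow> 'a::real_inner \<Rightarrow> real) \<Rightarrow> (nat \<Rightarrow> 'a) \<Rightarrow> bool" where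
  "ogd T \<eta> f x \<longleftrightarrow> (\<forall>t\<in>{1..T}. x t = x (t - 1) - \<eta> *\<^sub>R grad (f t) (x (t - 1)))"

end

theory Submission
  imports Defs
begin

text \<open>
  The tracking error obeys a linear recursion. On a ball around the minimizer of a strongly convex
  and smooth loss, one gradient step contracts the distance to that minimizer by the factor
  \<open>\<rho> < 1\<close>. Exchanging the minimizer for the target position before and after that step costs one
  estimation error each time, and the target itself moves between two steps, so
  \<open>\<parallel>x t - xstar t\<parallel> \<le> \<rho> \<parallel>x (t - 1) - xstar (t - 1)\<parallel> + \<parallel>xstar t - xstar (t - 1)\<parallel> + 2 E t\<close>,
  where \<open>E t\<close>, of order \<open>\<sigma> t + (\<sigma> t)\<^sup>2\<close>, bounds the estimation error at time \<open>t\<close>. The lower bound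
  on \<open>\<kappa>\<close> says exactly that \<open>\<rho> \<kappa>\<close> plus the largest possible displacement of the minimizer,
  namely the largest step of the target plus two estimation errors, is at most \<open>\<kappa>\<close>, so the
  iterates never leave the balls (\<open>ogd_stays_in_balls\<close>). Summing the recursion
  (\<open>sum_le_of_linear_recursion\<close>) bounds \<open>1 - \<rho>\<close> times the cumulative error by the path length plus
  three times the total of the \<open>E t\<close>; the third copy pays for the initial error, whose bound at
  the maximal noise level is itself one of the \<open>E t\<close>.

  The delicate part is the contraction (\<open>gradient_step_contracts\<close>). It rests on the inequality
  \<open>(\<mu> + L) (G z - G y) \<bullet> (z - y) \<ge> \<parallel>G z - G y\<parallel>\<^sup>2 + \<mu> L \<parallel>z - y\<parallel>\<^sup>2\<close> for the gradient \<open>G\<close>. The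
  textbook proof evaluates the function at an auxiliary point near \<open>z\<close>, which may lie outside the ball
  on which strong convexity and smoothness are known. But the inequality holds for close points
  away from the boundary (\<open>cocoercive_near\<close>), and it passes from the two halves of a segment to the
  whole segment (\<open>cocoercive_join\<close>); bisection and continuity up to the boundary give it on the
  closed ball, with the center as one of the points.
\<close>

section \<open>Cocoercivity of the gradient on a ball\<close>

lemma
  assumes "strongly_convex_smooth_on S f \<mu> L" "x \<in> S" "y \<in> S"
  shows scs_lower: "f y + grad f y \<bullet> (x - y) + \<mu> / 2 * (norm (x - y))\<^sup>2 \<le> f x"
    and scs_lipschitz: "norm (grad f x - grad f y) \<le> L * norm (x - y)"
  using assms unfolding strongly_convex_smooth_on_def by (auto simp: norm_minus_commute)

text \<open>Add the strong convexity inequality to the one with the points exchanged.\<close>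
lemma scs_strongly_monotone:
  assumes "strongly_convex_smooth_on S f \<mu> L" "x \<in> S" "y \<in> S"
  shows "\<mu> * (norm (x - y))\<^sup>2 \<le> (grad f x - grad f y) \<bullet> (x - y)"
proof -
  have "grad f y \<bullet> (x - y) + grad f x \<bullet> (y - x) = - ((grad f x - grad f y) \<bullet> (x - y))"
    by (simp add: inner_diff_left inner_diff_right)
  then show ?thesis
    using scs_lower[OF assms] scs_lower[OF assms(1) assms(3) assms(2)]
    by (simp add: norm_minus_commute)
qed

text \<open>
  Convexity and the Lipschitz bound at once give this estimate with \<open>L\<close> in place of \<open>L / 2\<close>.
  Applying an estimate with constant \<open>c\<close> on both halves of the segment improves it to
  \<open>c / 2 + L / 4\<close>, and this iteration converges to \<open>L / 2\<close>.
\<close>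
lemma scs_upper:
  assumes scs: "strongly_convex_smooth_on S f \<mu> L" and "convex S" "0 \<le> \<mu>" "x \<in> S" "y \<in> S"
  shows "f x \<le> f y + grad f y \<bullet> (x - y) + L / 2 * (norm (x - y))\<^sup>2"
proof -
  have iter: "f x \<le> f y + grad f y \<bullet> (x - y) + (L / 2 * (1 + (1/2)^n)) * (norm (x - y))\<^sup>2"
    if "x \<in> S" "y \<in> S" for n x y
    using that
  proof (induction n arbitrary: x y)
    case 0
    have "f x + grad f x \<bullet> (y - x) \<le> f y"
      using scs_lower[OF scs 0(2) 0(1)] \<open>0 \<le> \<mu>\<close>
      by (smt (verit) mult_nonneg_nonneg zero_le_power2 divide_nonneg_nonneg)
    moreover have "(grad f x - grad f y) \<bullet> (x - y) \<le> L * norm (x - y) * norm (x - y)"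
      using norm_cauchy_schwarz[of "grad f x - grad f y" "x - y"] scs_lipschitz[OF scs 0]
      by (meson mult_right_mono norm_ge_zero order_trans)
    ultimately show ?case
      by (simp add: inner_diff_left inner_diff_right power2_eq_square)
  next
    case (Suc n)
    define z where "z = y + (1/2) *\<^sub>R (x - y)"
    have "z = (1/2) *\<^sub>R y + (1/2) *\<^sub>R x"
      unfolding z_def by (simp add: algebra_simps flip: scaleR_left.add)
    then have zS: "z \<in> S"
      using convexD[OF \<open>convex S\<close> Suc.prems(2,1), of "1/2" "1/2"] by simp
    have zy: "z - y = (1/2) *\<^sub>R (x - y)" unfolding z_def by simp
    have xz: "x - z = (1/2) *\<^sub>R (x - y)"
      unfolding z_def by (simp add: algebra_simps flip: scaleR_left.add)
    let ?D = "(norm (x - y))\<^sup>2"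
    define k where "k = L / 2 * (1 + (1/2)^n)"
    have "f z \<le> f y + (grad f y \<bullet> (x - y)) / 2 + k * (?D / 4)"
      using Suc.IH[OF zS Suc.prems(2)] unfolding zy k_def[symmetric] by (simp add: power_divide)
    moreover have "f x \<le> f z + (grad f z \<bullet> (x - y)) / 2 + k * (?D / 4)"
      using Suc.IH[OF Suc.prems(1) zS] unfolding xz k_def[symmetric] by (simp add: power_divide)
    moreover have "(grad f z - grad f y) \<bullet> (x - y) \<le> L / 2 * ?D"
    proof -
      have "(grad f z - grad f y) \<bullet> (x - y) \<le> norm (grad f z - grad f y) * norm (x - y)"
        by (rule norm_cauchy_schwarz)
      also have "\<dots> \<le> (L * norm (z - y)) * norm (x - y)"
        by (intro mult_right_mono scs_lipschitz[OF scs zS Suc.prems(2)]) simp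
      finally show ?thesis unfolding zy by (simp add: power2_eq_square)
    qed
    ultimately have "f x \<le> f y + grad f y \<bullet> (x - y) + (L / 4 + k / 2) * ?D"
      unfolding inner_diff_left distrib_right by linarith
    moreover have "L / 4 + k / 2 = L / 2 * (1 + (1/2) ^ Suc n)"
      unfolding k_def by (simp add: field_simps)
    ultimately show ?case by metis
  qed
  have "(\<lambda>n. f y + grad f y \<bullet> (x - y) + (L / 2 * (1 + (1/2)^n)) * (norm (x - y))\<^sup>2)
      \<longlonglongrightarrow> f y + grad f y \<bullet> (x - y) + (L / 2 * (1 + 0)) * (norm (x - y))\<^sup>2"
    by (intro tendsto_intros LIMSEQ_power_zero) simp
  then show ?thesis
    using iter[OF assms(4,5)] by (intro LIMSEQ_le_const) auto
qed

text \<open>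
  For the gradient of a function with modulus of convexity \<open>\<mu>\<close> and smoothness constant \<open>L\<close>, this
  inequality is the cocoercivity of \<open>G - \<mu> id\<close> with constant \<open>1 / (L - \<mu>)\<close>, written in terms of \<open>G\<close>
  and without the division.
\<close>
definition cocoercive_at :: "real \<Rightarrow> real \<Rightarrow> ('a::real_inner \<Rightarrow> 'a) \<Rightarrow> 'a \<Rightarrow> 'a \<Rightarrow> bool" where
  "cocoercive_at \<mu> L G y z \<longleftrightarrow>
     (norm (G z - G y))\<^sup>2 + \<mu> * L * (norm (z - y))\<^sup>2 \<le> (\<mu> + L) * ((G z - G y) \<bullet> (z - y))"

text \<open>
  Put \<open>g x = f x - \<mu>/2 \<parallel>x\<parallel>\<^sup>2\<close>, \<open>M = L - \<mu>\<close> and \<open>q = (G z - \<mu> z) - (G y - \<mu> y)\<close>, the gradient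
  difference of \<open>g\<close>. Bounding \<open>g\<close> at \<open>z - q / M\<close> from below from \<open>y\<close> and from above from \<open>z\<close> gives
  half of the cocoercivity inequality of \<open>g\<close>; the other half exchanges \<open>y\<close> and \<open>z\<close>.
  The lemma is that half, expressed through \<open>f\<close>.
\<close>
lemma bregman_lower:
  fixes y z :: "'a::real_inner"
  assumes scs: "strongly_convex_smooth_on S f \<mu> L" and "convex S" "0 \<le> \<mu>" "\<mu> < L"
    and "y \<in> S" "z \<in> S"
    and q: "q = (grad f z - grad f y) - \<mu> *\<^sub>R (z - y)" and "z - q /\<^sub>R (L - \<mu>) \<in> S"
  shows "\<mu> * (norm (z - y))\<^sup>2 + (norm q)\<^sup>2 / (L - \<mu>) \<le> 2 * (f z - f y - grad f y \<bullet> (z - y))"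
proof -
  define s where "s = 1 / (L - \<mu>)"
  define w where "w = z - s *\<^sub>R q"
  have w: "w \<in> S" using assms(8) unfolding w_def s_def by (simp add: divide_inverse)
  have lower: "f y + grad f y \<bullet> (w - y) + \<mu> / 2 * (norm (w - y))\<^sup>2 \<le> f w"
    by (rule scs_lower[OF scs w \<open>y \<in> S\<close>])
  have upper: "f w \<le> f z + grad f z \<bullet> (w - z) + L / 2 * (norm (w - z))\<^sup>2"
    by (rule scs_upper[OF scs assms(2,3) w \<open>z \<in> S\<close>])
  have e1: "grad f y \<bullet> (w - y) = grad f y \<bullet> (z - y) - s * (grad f y \<bullet> q)"
    unfolding w_def by (simp add: inner_diff_right)
  have e2: "grad f z \<bullet> (w - z) = - s * (grad f z \<bullet> q)"
    unfolding w_def by (simp add: inner_diff_right)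
  have e3: "(norm (w - y))\<^sup>2 = (norm (z - y))\<^sup>2 - 2 * s * ((z - y) \<bullet> q) + s\<^sup>2 * (norm q)\<^sup>2"
    unfolding w_def power2_norm_eq_inner
    by (simp add: inner_diff_left inner_diff_right inner_commute power2_eq_square algebra_simps)
  have e4: "(norm (w - z))\<^sup>2 = s\<^sup>2 * (norm q)\<^sup>2"
    unfolding w_def by (simp add: power_mult_distrib)
  have qq: "grad f z \<bullet> q - grad f y \<bullet> q = (norm q)\<^sup>2 + \<mu> * ((z - y) \<bullet> q)"
  proof -
    have "q \<bullet> q = (grad f z - grad f y) \<bullet> q - \<mu> * ((z - y) \<bullet> q)"
      by (metis q inner_diff_left inner_scaleR_left)
    then show ?thesis by (simp add: power2_norm_eq_inner inner_diff_left)
  qed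
  have sM: "s * (L - \<mu>) = 1" using \<open>\<mu> < L\<close> unfolding s_def by simp
  have "f y + grad f y \<bullet> (z - y) + \<mu> / 2 * (norm (z - y))\<^sup>2
      + s * ((grad f z \<bullet> q - grad f y \<bullet> q) - \<mu> * ((z - y) \<bullet> q))
      - (s * (L - \<mu>)) * s / 2 * (norm q)\<^sup>2 \<le> f z"
  proof -
    have "f y + grad f y \<bullet> (z - y) + \<mu> / 2 * (norm (z - y))\<^sup>2
      + s * ((grad f z \<bullet> q - grad f y \<bullet> q) - \<mu> * ((z - y) \<bullet> q))
      - (s * (L - \<mu>)) * s / 2 * (norm q)\<^sup>2
      = (f y + grad f y \<bullet> (w - y) + \<mu> / 2 * (norm (w - y))\<^sup>2)
        - (grad f z \<bullet> (w - z) + L / 2 * (norm (w - z))\<^sup>2)"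
      unfolding e1 e2 e3 e4 by (simp add: field_simps power2_eq_square)
    then show ?thesis using lower upper by linarith
  qed
  then have "f y + grad f y \<bullet> (z - y) + \<mu> / 2 * (norm (z - y))\<^sup>2 + s * (norm q)\<^sup>2 / 2 \<le> f z"
    unfolding qq sM by simp
  moreover have "(norm q)\<^sup>2 / (L - \<mu>) = s * (norm q)\<^sup>2"
    unfolding s_def by simp
  ultimately show ?thesis by simp
qed

text \<open>
  The radius \<open>(L + \<mu>) / (L - \<mu>) \<parallel>z - y\<parallel>\<close> is what keeps the auxiliary points of
  \<open>bregman_lower\<close> in \<open>S\<close>. For \<open>\<mu> = L\<close> that lemma is void, but then strong monotonicity and the
  Lipschitz bound alone give the claim.
\<close>
lemma cocoercive_near:
  fixes y z :: "'a::real_inner"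
  assumes scs: "strongly_convex_smooth_on S f \<mu> L" and "convex S" "0 < \<mu>" "0 < L"
    and yS: "y \<in> S" and zS: "z \<in> S"
    and ballS: "\<mu> < L \<Longrightarrow> cball y ((L + \<mu>) / (L - \<mu>) * norm (z - y)) \<subseteq> S"
      "\<mu> < L \<Longrightarrow> cball z ((L + \<mu>) / (L - \<mu>) * norm (z - y)) \<subseteq> S"
  shows "cocoercive_at \<mu> L (grad f) y z"
proof -
  define p where "p = grad f z - grad f y"
  define d where "d = z - y"
  have mono: "\<mu> * (norm d)\<^sup>2 \<le> p \<bullet> d"
    unfolding p_def d_def by (rule scs_strongly_monotone[OF scs zS yS])
  have lip: "norm p \<le> L * norm d"
    unfolding p_def d_def by (rule scs_lipschitz[OF scs zS yS])
  consider "d = 0" | "d \<noteq> 0" "L \<le> \<mu>" | "\<mu> < L" by linarith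
  then have "(norm p)\<^sup>2 + \<mu> * L * (norm d)\<^sup>2 \<le> (\<mu> + L) * (p \<bullet> d)"
  proof cases
    case 1
    then show ?thesis using lip by simp
  next
    case 2
    have "\<mu> * (norm d)\<^sup>2 \<le> L * (norm d)\<^sup>2"
    proof -
      have "p \<bullet> d \<le> norm p * norm d" by (rule norm_cauchy_schwarz)
      also have "\<dots> \<le> (L * norm d) * norm d" by (intro mult_right_mono lip) simp
      finally show ?thesis using mono by (simp add: power2_eq_square)
    qed
    with 2 have "\<mu> = L" by simp
    have "(norm p)\<^sup>2 \<le> (L * norm d)\<^sup>2" by (intro power_mono lip) simp
    moreover have "L * (L * (norm d)\<^sup>2) \<le> L * (p \<bullet> d)"
      using mono \<open>\<mu> = L\<close> \<open>0 < L\<close> by (intro mult_left_mono) auto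
    ultimately show ?thesis
      unfolding \<open>\<mu> = L\<close> by (simp add: power_mult_distrib power2_eq_square algebra_simps)
  next
    case 3
    define q where "q = p - \<mu> *\<^sub>R d"
    have "norm q \<le> (L + \<mu>) * norm d"
      using norm_triangle_ineq4[of p "\<mu> *\<^sub>R d"] lip \<open>0 < \<mu>\<close> unfolding q_def
      by (simp add: algebra_simps)
    then have small: "norm (q /\<^sub>R (L - \<mu>)) \<le> (L + \<mu>) / (L - \<mu>) * norm d"
      using 3 divide_right_mono[of _ _ "L - \<mu>"] by (simp add: divide_inverse_commute mult.assoc)
    have "z - q /\<^sub>R (L - \<mu>) \<in> S"
      using ballS(2)[OF 3] small unfolding d_def by (auto simp: dist_norm)
    from bregman_lower[OF scs assms(2) less_imp_le[OF \<open>0 < \<mu>\<close>] 3 yS zS _ this]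
    have half1: "\<mu> * (norm d)\<^sup>2 + (norm q)\<^sup>2 / (L - \<mu>) \<le> 2 * (f z - f y - grad f y \<bullet> d)"
      unfolding q_def p_def d_def by simp
    have "y - (- q) /\<^sub>R (L - \<mu>) \<in> S"
      using ballS(1)[OF 3] small unfolding d_def by (auto simp: dist_norm)
    from bregman_lower[OF scs assms(2) less_imp_le[OF \<open>0 < \<mu>\<close>] 3 zS yS _ this]
    have half2: "\<mu> * (norm d)\<^sup>2 + (norm q)\<^sup>2 / (L - \<mu>) \<le> 2 * (f y - f z - grad f z \<bullet> (y - z))"
      unfolding q_def p_def d_def by (simp add: algebra_simps norm_minus_commute)
    have "grad f z \<bullet> (y - z) + grad f y \<bullet> d = - (p \<bullet> d)"
      unfolding p_def d_def by (simp add: inner_diff_left inner_diff_right)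
    then have "\<mu> * (norm d)\<^sup>2 + (norm q)\<^sup>2 / (L - \<mu>) \<le> p \<bullet> d"
      using half1 half2 unfolding right_diff_distrib by linarith
    then have key: "(norm q)\<^sup>2 \<le> (L - \<mu>) * (p \<bullet> d - \<mu> * (norm d)\<^sup>2)"
      using 3 by (simp add: field_simps)
    have "(norm q)\<^sup>2 = (norm p)\<^sup>2 - 2 * \<mu> * (p \<bullet> d) + \<mu>\<^sup>2 * (norm d)\<^sup>2"
      unfolding q_def power2_norm_eq_inner
      by (simp add: inner_diff_left inner_diff_right inner_commute power2_eq_square algebra_simps)
    with key show ?thesis by (simp add: power2_eq_square algebra_simps)
  qed
  then show ?thesis unfolding cocoercive_at_def p_def d_def .
qed

text \<open>
  Both sides of the inequality are quadratic: the increments over the two halves satisfy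
  \<open>\<parallel>g1 + g2\<parallel>\<^sup>2 \<le> 2 (\<parallel>g1\<parallel>\<^sup>2 + \<parallel>g2\<parallel>\<^sup>2)\<close>, and the two halves have the same direction.
\<close>
lemma cocoercive_join:
  fixes y z :: "'a::real_inner"
  assumes "x = y + (1/2) *\<^sub>R (z - y)" "cocoercive_at \<mu> L G y x" "cocoercive_at \<mu> L G x z"
  shows "cocoercive_at \<mu> L G y z"
proof -
  define u where "u = G x - G y"
  define v where "v = G z - G x"
  have xy: "x - y = (1/2) *\<^sub>R (z - y)" using assms(1) by simp
  have zx: "z - x = (1/2) *\<^sub>R (z - y)"
    unfolding assms(1) by (simp add: algebra_simps flip: scaleR_left.add)
  let ?D = "(norm (z - y))\<^sup>2"
  have "(norm u)\<^sup>2 + \<mu> * L * (?D / 4) \<le> (\<mu> + L) * (u \<bullet> (z - y) / 2)"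
    using assms(2) unfolding cocoercive_at_def xy u_def by (simp add: power_divide)
  moreover have "(norm v)\<^sup>2 + \<mu> * L * (?D / 4) \<le> (\<mu> + L) * (v \<bullet> (z - y) / 2)"
    using assms(3) unfolding cocoercive_at_def zx v_def by (simp add: power_divide)
  moreover have "(norm (u + v))\<^sup>2 \<le> 2 * (norm u)\<^sup>2 + 2 * (norm v)\<^sup>2"
  proof -
    have "(norm (u + v))\<^sup>2 + (norm (u - v))\<^sup>2 = 2 * (norm u)\<^sup>2 + 2 * (norm v)\<^sup>2"
      unfolding power2_norm_eq_inner
      by (simp add: inner_add_left inner_add_right inner_diff_left inner_diff_right)
    then show ?thesis by (smt (verit) zero_le_power2)
  qed
  ultimately have "(norm (u + v))\<^sup>2 + \<mu> * L * ?D \<le> (\<mu> + L) * ((u + v) \<bullet> (z - y))"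
    by (simp add: inner_add_left algebra_simps)
  moreover have "u + v = G z - G y" unfolding u_def v_def by simp
  ultimately show ?thesis unfolding cocoercive_at_def by metis
qed

text \<open>
  A set \<open>S'\<close> at distance \<open>\<epsilon>\<close> from the boundary of \<open>S\<close> leaves room for \<open>cocoercive_near\<close> on all
  sufficiently short segments; bisection reaches the long ones.
\<close>
lemma cocoercive_away_from_boundary:
  fixes y z :: "'a::real_inner"
  assumes scs: "strongly_convex_smooth_on S f \<mu> L" and "convex S" "0 < \<mu>" "0 < L"
    and "convex S'" "0 < \<epsilon>" and room: "\<And>x. x \<in> S' \<Longrightarrow> cball x \<epsilon> \<subseteq> S"
    and "y \<in> S'" "z \<in> S'"
  shows "cocoercive_at \<mu> L (grad f) y z"
proof -
  define b where "b = (if \<mu> < L then \<epsilon> * (L - \<mu>) / (L + \<mu>) else 1)"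
  have "b > 0" using assms(3,4,6) unfolding b_def by simp
  have bisect: "cocoercive_at \<mu> L (grad f) y z"
    if "y \<in> S'" "z \<in> S'" "norm (z - y) \<le> 2 ^ n * b" for n y z
    using that
  proof (induction n arbitrary: y z)
    case 0
    have "(L + \<mu>) / (L - \<mu>) * norm (z - y) \<le> \<epsilon>" if "\<mu> < L"
      using 0(3) that assms(3,4) unfolding b_def by (simp add: field_simps)
    then show ?case
      using room[OF 0(1)] room[OF 0(2)] \<open>0 < \<epsilon>\<close>
      by (intro cocoercive_near[OF scs assms(2-4)])
        (auto intro: order_trans[OF subset_cball] simp: subset_iff)
  next
    case (Suc n)
    define x where "x = y + (1/2) *\<^sub>R (z - y)"
    have "x = (1/2) *\<^sub>R y + (1/2) *\<^sub>R z"
      unfolding x_def by (simp add: algebra_simps flip: scaleR_left.add)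
    then have "x \<in> S'"
      using convexD[OF \<open>convex S'\<close> Suc.prems(1,2), of "1/2" "1/2"] by simp
    have "x - y = (1/2) *\<^sub>R (z - y)" "z - x = (1/2) *\<^sub>R (z - y)"
      unfolding x_def by (simp_all add: algebra_simps flip: scaleR_left.add)
    then have "norm (x - y) \<le> 2 ^ n * b" "norm (z - x) \<le> 2 ^ n * b"
      using Suc.prems(3) by simp_all
    then show ?case
      using Suc.IH \<open>x \<in> S'\<close> Suc.prems(1,2) by (intro cocoercive_join[OF x_def]) auto
  qed
  obtain n where "norm (z - y) / b < 2 ^ n"
    using real_arch_pow[of 2 "norm (z - y) / b"] by auto
  then have "norm (z - y) \<le> 2 ^ n * b"
    using \<open>b > 0\<close> by (simp add: field_simps)
  then show ?thesis by (rule bisect[OF assms(8,9)])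
qed

lemma cocoercive_at_center:
  fixes c x :: "'a::real_inner"
  assumes scs: "strongly_convex_smooth_on (cball c r) f \<mu> L" and "0 < \<mu>" "0 < L" "0 < r"
    and "x \<in> cball c r"
  shows "cocoercive_at \<mu> L (grad f) c x"
proof -
  define h where "h x = (\<mu> + L) * ((grad f x - grad f c) \<bullet> (x - c))
      - ((norm (grad f x - grad f c))\<^sup>2 + \<mu> * L * (norm (x - c))\<^sup>2)" for x
  have "L-lipschitz_on (cball c r) (grad f)"
    using scs_lipschitz[OF scs] \<open>0 < L\<close> by (intro lipschitz_onI) (auto simp: dist_norm)
  then have cont: "continuous_on (cball c r) (grad f)"
    by (rule lipschitz_on_continuous_on)
  have "continuous_on (closure (ball c r)) h"
    unfolding h_def closure_ball[OF \<open>0 < r\<close>] by (intro continuous_intros cont)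
  moreover have "0 \<le> h x" if "x \<in> ball c r" for x
  proof -
    have "cocoercive_at \<mu> L (grad f) c x"
    proof (rule cocoercive_away_from_boundary[OF scs convex_cball assms(2,3)
          convex_cball[of c "dist c x"], of "r - dist c x"])
      show "cball y (r - dist c x) \<subseteq> cball c r" if "y \<in> cball c (dist c x)" for y
        using that by (simp add: cball_subset_cball_iff dist_commute)
          (smt (verit) dist_commute dist_triangle mem_cball subsetI)
    qed (use that in auto)
    then show ?thesis unfolding h_def cocoercive_at_def by simp
  qed
  ultimately have "0 \<le> h x"
    using \<open>x \<in> cball c r\<close>
    by (intro continuous_ge_on_closure[of "ball c r" h x 0])
      (auto simp: closure_ball[OF \<open>0 < r\<close>])
  then show ?thesis unfolding h_def cocoercive_at_def by simp
qed

section \<open>One gradient step\<close>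

text \<open>
  A nonzero gradient \<open>g\<close> at \<open>c\<close> would make \<open>f\<close> decrease along \<open>-g\<close>, by \<open>scs_upper\<close>. The
  step length \<open>min (1/L) (r / \<parallel>g\<parallel>)\<close> makes the linear term dominate and stays in the ball.
\<close>
lemma grad_zero_at_center_minimum:
  fixes c :: "'a::real_inner"
  assumes scs: "strongly_convex_smooth_on (cball c r) f \<mu> L" and "0 \<le> \<mu>" "0 < L" "0 < r"
    and min: "\<And>x. f c \<le> f x"
  shows "grad f c = 0"
proof (rule ccontr)
  define g where "g = grad f c"
  assume "grad f c \<noteq> 0"
  then have g: "norm g > 0" unfolding g_def by simp
  define s where "s = min (1 / L) (r / norm g)"
  have s: "s > 0" "s * L \<le> 1" "s * norm g \<le> r"
    using g \<open>0 < L\<close> \<open>0 < r\<close> unfolding s_def by (auto simp: min_def field_simps)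
  define x where "x = c - s *\<^sub>R g"
  have "x \<in> cball c r" using s unfolding x_def by (simp add: dist_norm)
  then have "f x \<le> f c + g \<bullet> (x - c) + L / 2 * (norm (x - c))\<^sup>2"
    using scs_upper[OF scs convex_cball \<open>0 \<le> \<mu>\<close>, of x c] \<open>0 < r\<close> unfolding g_def by simp
  also have "\<dots> = f c - s * (norm g)\<^sup>2 * (1 - s * L / 2)"
  proof -
    have "x - c = - (s *\<^sub>R g)" unfolding x_def by simp
    show ?thesis
      unfolding \<open>x - c = - (s *\<^sub>R g)\<close> using s(1)
      by (simp add: power_mult_distrib power2_eq_square algebra_simps flip: power2_norm_eq_inner)
  qed
  also have "\<dots> < f c" using s g by simp
  finally show False using min[of x] by simp
qed

text \<open>
  Expanding the square, cocoercivity against the center, where the gradient vanishes, bounds the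
  cross term, and \<open>\<eta> \<le> 2 / (\<mu> + L)\<close> makes the coefficient of \<open>\<parallel>grad f x\<parallel>\<^sup>2\<close> nonpositive.
\<close>
lemma gradient_step_contracts:
  fixes c x :: "'a::real_inner"
  assumes scs: "strongly_convex_smooth_on (cball c r) f \<mu> L" and "0 < \<mu>" "0 < L" "0 < r"
    and min: "\<And>x. f c \<le> f x"
    and \<eta>: "0 < \<eta>" "\<eta> \<le> 2 / (\<mu> + L)" and rho: "0 \<le> rho \<eta> \<mu> L"
    and x: "x \<in> cball c r"
  shows "norm (x - \<eta> *\<^sub>R grad f x - c) \<le> rho \<eta> \<mu> L * norm (x - c)"
proof -
  define d where "d = x - c"
  define p where "p = grad f x"
  have "cocoercive_at \<mu> L (grad f) c x"
    by (rule cocoercive_at_center[OF scs assms(2-4) x])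
  then have "(norm p)\<^sup>2 + \<mu> * L * (norm d)\<^sup>2 \<le> (\<mu> + L) * (p \<bullet> d)"
    using grad_zero_at_center_minimum[OF scs less_imp_le[OF \<open>0 < \<mu>\<close>] assms(3,4) min]
    unfolding cocoercive_at_def p_def d_def by simp
  then have "((norm p)\<^sup>2 + \<mu> * L * (norm d)\<^sup>2) / (\<mu> + L) \<le> p \<bullet> d"
    using assms(2,3) by (simp add: field_simps)
  then have cross: "2 * \<eta> * (((norm p)\<^sup>2 + \<mu> * L * (norm d)\<^sup>2) / (\<mu> + L)) \<le> 2 * \<eta> * (p \<bullet> d)"
    using \<eta>(1) by (intro mult_left_mono) auto
  have "\<eta> * (\<eta> * (norm p)\<^sup>2) \<le> \<eta> * (2 / (\<mu> + L) * (norm p)\<^sup>2)"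
    using \<eta> by (intro mult_left_mono mult_right_mono) auto
  moreover have "(norm (d - \<eta> *\<^sub>R p))\<^sup>2 = (norm d)\<^sup>2 - 2 * \<eta> * (p \<bullet> d) + \<eta> * (\<eta> * (norm p)\<^sup>2)"
    unfolding power2_norm_eq_inner
    by (simp add: inner_diff_left inner_diff_right inner_commute algebra_simps)
  ultimately have "(norm (d - \<eta> *\<^sub>R p))\<^sup>2 \<le> (1 - 2 * \<eta> * \<mu> * L / (\<mu> + L)) * (norm d)\<^sup>2"
    using cross by (simp add: algebra_simps add_divide_distrib)
  also have "\<dots> = (rho \<eta> \<mu> L * norm d)\<^sup>2"
    using rho unfolding rho_def by (simp add: power_mult_distrib)
  finally have "norm (d - \<eta> *\<^sub>R p) \<le> rho \<eta> \<mu> L * norm d"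
    by (rule power2_le_imp_le) (simp add: rho)
  then show ?thesis unfolding d_def p_def by (simp add: algebra_simps)
qed

section \<open>Tracking a moving minimizer\<close>

text \<open>
  A step from the ball of radius \<open>\<kappa>\<close> around the current minimizer \<open>c t\<close> leads into the ball of
  radius \<open>\<rho> \<kappa>\<close> around it. The triangle inequality through the target positions \<open>u\<close> then places the
  iterate in the ball of radius \<open>\<rho> \<kappa> + 2 E + v \<le> \<kappa>\<close> around the next one.
\<close>
lemma ogd_stays_in_balls:
  fixes x c u :: "nat \<Rightarrow> 'a::real_normed_vector"
  assumes step: "\<And>t. t \<in> {1..T} \<Longrightarrow> norm (x (t - 1) - c t) \<le> \<kappa> \<Longrightarrow>
      norm (x t - c t) \<le> \<rho> * norm (x (t - 1) - c t)"
    and near: "\<And>t. t \<in> {1..T} \<Longrightarrow> norm (c t - u t) \<le> E"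
    and move: "\<And>t. t \<in> {1..T - 1} \<Longrightarrow> norm (u (t + 1) - u t) \<le> v"
    and init: "norm (x 0 - u 1) \<le> E" and "0 \<le> v" "0 \<le> \<rho>" "2 * E + v \<le> (1 - \<rho>) * \<kappa>" "0 \<le> \<kappa>"
    and t: "t \<in> {1..T}"
  shows "norm (x (t - 1) - c t) \<le> \<kappa>"
proof -
  have "t \<ge> 1" using t by simp
  then show ?thesis using t
  proof (induction t rule: nat_induct_at_least)
    case base
    have "norm (x 0 - c 1) \<le> norm (x 0 - u 1) + norm (c 1 - u 1)"
      using norm_triangle_ineq4[of "x 0 - u 1" "c 1 - u 1"] by simp
    also have "\<dots> \<le> 2 * E" using init near[OF base] by simp
    also have "\<dots> \<le> \<kappa>"
      using mult_nonneg_nonneg[OF assms(6,8)] assms(5,7) by (simp add: left_diff_distrib)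
    finally show ?case by simp
  next
    case (Suc t)
    then have t: "t \<in> {1..T}" "t \<in> {1..T - 1}" by auto
    have in_ball: "norm (x (t - 1) - c t) \<le> \<kappa>" by (rule Suc.IH[OF t(1)])
    have "norm (x t - c (Suc t))
        \<le> norm (x t - c t) + norm (c t - u t) + norm (u (t + 1) - u t)
          + norm (c (Suc t) - u (Suc t))"
    proof -
      have "x t - c (Suc t) = (x t - u t) - (u (t + 1) - u t) - (c (Suc t) - u (Suc t))"
        by simp
      also have "norm \<dots> \<le> norm (x t - u t) + norm (u (t + 1) - u t) + norm (c (Suc t) - u (Suc t))"
        by (rule order_trans[OF norm_triangle_ineq4 add_right_mono[OF norm_triangle_ineq4]])
      also have "norm (x t - u t) \<le> norm (x t - c t) + norm (c t - u t)"
        using norm_triangle_ineq[of "x t - c t" "c t - u t"] by simp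
      finally show ?thesis by simp
    qed
    also have "\<dots> \<le> \<rho> * norm (x (t - 1) - c t) + E + v + E"
      by (intro add_mono step near move t Suc.prems in_ball)
    also have "\<dots> \<le> \<rho> * \<kappa> + E + v + E"
      using mult_left_mono[OF in_ball \<open>0 \<le> \<rho>\<close>] by simp
    also have "\<dots> \<le> \<kappa>" using assms(7) by (simp add: algebra_simps)
    finally show ?case by simp
  qed
qed

text \<open>The term \<open>\<rho> * e T\<close> on the left is what the next step of the induction consumes.\<close>
lemma sum_le_of_linear_recursion:
  fixes e b :: "nat \<Rightarrow> real"
  assumes "T \<ge> 1" and "e 1 \<le> B + b 1"
    and "\<And>t. t \<in> {1..T - 1} \<Longrightarrow> e (t + 1) \<le> \<rho> * e t + d t + b (t + 1)"
  shows "(1 - \<rho>) * (\<Sum>t=1..T. e t) + \<rho> * e T \<le> B + (\<Sum>t=1..T - 1. d t) + (\<Sum>t=1..T. b t)"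
  using assms
proof (induction T rule: nat_induct_at_least)
  case base
  then show ?case by (simp add: algebra_simps)
next
  case (Suc T)
  have "(1 - \<rho>) * (\<Sum>t=1..T. e t) + \<rho> * e T \<le> B + (\<Sum>t=1..T - 1. d t) + (\<Sum>t=1..T. b t)"
    using Suc.prems by (intro Suc.IH) auto
  moreover have "e (Suc T) \<le> \<rho> * e T + d T + b (Suc T)"
    using Suc.prems(2)[of T] Suc.hyps by simp
  moreover have "(\<Sum>t=1..Suc T - 1. d t) = (\<Sum>t=1..T - 1. d t) + d T"
    using Suc.hyps by (cases T) auto
  moreover have "(\<Sum>t=1..Suc T. e t) = (\<Sum>t=1..T. e t) + e (Suc T)"
    "(\<Sum>t=1..Suc T. b t) = (\<Sum>t=1..T. b t) + b (Suc T)" by simp_all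
  ultimately show ?case by (simp only: distrib_left left_diff_distrib mult_1)
qed

lemma err_bound_nonneg:
  assumes "0 \<le> K1" "0 \<le> K2" "0 \<le> \<sigma>"
  shows "0 \<le> err_bound m K1 K2 \<sigma>"
  using assms unfolding err_bound_def by simp

lemma err_bound_mono:
  assumes "0 \<le> K1" "0 \<le> K2" "0 \<le> \<sigma>" "\<sigma> \<le> \<sigma>'"
  shows "err_bound m K1 K2 \<sigma> \<le> err_bound m K1 K2 \<sigma>'"
  unfolding err_bound_def
  by (intro add_mono[OF mult_left_mono mult_left_mono] power_mono) (use assms in auto)

lemma sigma_max_attained:
  assumes "T \<ge> 1" "\<And>t. t \<in> {1..T} \<Longrightarrow> 0 \<le> \<sigma> t"
  obtains t where "t \<in> {1..T}" "sigma_max T \<sigma> = \<sigma> t"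
proof -
  have "Max ((\<lambda>t. (\<sigma> t)\<^sup>2) ` {1..T}) \<in> (\<lambda>t. (\<sigma> t)\<^sup>2) ` {1..T}"
    using assms(1) by (intro Max_in) auto
  then obtain t where "t \<in> {1..T}" "Max ((\<lambda>t. (\<sigma> t)\<^sup>2) ` {1..T}) = (\<sigma> t)\<^sup>2" by auto
  then show ?thesis using assms(2) by (intro that) (simp_all add: sigma_max_def)
qed

lemma sigma_le_sigma_max:
  assumes "t \<in> {1..T}" "0 \<le> \<sigma> t"
  shows "\<sigma> t \<le> sigma_max T \<sigma>"
  unfolding sigma_max_def using assms by (intro real_le_rsqrt Max_ge) auto

lemma sum_err_bound:
  "(\<Sum>t=1..T. err_bound m K1 K2 (\<sigma> t))
    = K1 * sqrt (real m) * cum_noise_std T \<sigma> + K2 * real m * cum_noise_var T \<sigma>"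
  unfolding err_bound_def cum_noise_std_def cum_noise_var_def
  by (simp add: sum.distrib sum_distrib_left)

section \<open>The cumulative tracking error\<close>

text \<open>
  Write \<open>E t\<close> for the error bound at noise level \<open>\<sigma> t\<close>. The contraction concerns the distance to
  \<open>xhat t\<close>; replacing \<open>xhat t\<close> by \<open>xstar t\<close> before and after the step costs \<open>E t\<close> each time, whence
  the terms \<open>2 E t\<close> in the recursion. The initial error is at most the error bound at the maximal
  noise level; this level is attained at some time \<open>t\<close>, so that bound is at most the sum of all \<open>E t\<close>.
\<close>
lemma ctte_bound:
  fixes x xhat xstar :: "nat \<Rightarrow> real^'n"
  assumes "T \<ge> 1" and K: "0 < K1" "0 < K2" and "0 < \<mu>" "0 < L"
    and \<eta>: "0 < \<eta>" "\<eta> \<le> 2 / (\<mu> + L)" and rho: "0 < rho \<eta> \<mu> L" "rho \<eta> \<mu> L < 1"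
    and \<sigma>: "\<And>t. t \<in> {1..T} \<Longrightarrow> 0 \<le> \<sigma> t"
    and est: "\<And>t. t \<in> {1..T} \<Longrightarrow> norm (xhat t - xstar t) \<le> err_bound m K1 K2 (\<sigma> t)"
    and min: "\<And>t y. t \<in> {1..T} \<Longrightarrow> f t (xhat t) \<le> f t y"
    and scs: "\<And>t. t \<in> {1..T} \<Longrightarrow> strongly_convex_smooth_on (cball (xhat t) \<kappa>) (f t) \<mu> L"
    and \<kappa>: "0 < \<kappa>"
      "\<kappa> \<ge> (2 * err_bound m K1 K2 (sigma_max T \<sigma>) + max_step T xstar) / (1 - rho \<eta> \<mu> L)"
    and init: "norm (x 0 - xstar 1) \<le> err_bound m K1 K2 (sigma_max T \<sigma>)"
    and ogd: "ogd T \<eta> f x"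
  shows "(1 - rho \<eta> \<mu> L) * CTTE T xstar x
    \<le> path_length T xstar + 3 * (\<Sum>t=1..T. err_bound m K1 K2 (\<sigma> t))"
proof -
  define E where "E t = err_bound m K1 K2 (\<sigma> t)" for t
  define Emax where "Emax = err_bound m K1 K2 (sigma_max T \<sigma>)"
  let ?\<rho> = "rho \<eta> \<mu> L"
  have E_nonneg: "0 \<le> E t" if "t \<in> {1..T}" for t
    unfolding E_def using K \<sigma>[OF that] by (intro err_bound_nonneg) auto
  have E_le: "E t \<le> Emax" if "t \<in> {1..T}" for t
    unfolding E_def Emax_def using K
    by (intro err_bound_mono sigma_le_sigma_max \<sigma>[OF that] that) auto
  have Emax_le: "Emax \<le> (\<Sum>t=1..T. E t)"
  proof -
    obtain t where "t \<in> {1..T}" "sigma_max T \<sigma> = \<sigma> t"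
      using sigma_max_attained[of T \<sigma>] \<open>T \<ge> 1\<close> \<sigma> by blast
    then show ?thesis
      unfolding Emax_def using member_le_sum[of t "{1..T}" E] E_nonneg by (simp add: E_def)
  qed
  have contract: "norm (x t - xhat t) \<le> ?\<rho> * norm (x (t - 1) - xhat t)"
    if t: "t \<in> {1..T}" and "norm (x (t - 1) - xhat t) \<le> \<kappa>" for t
  proof -
    have "x t = x (t - 1) - \<eta> *\<^sub>R grad (f t) (x (t - 1))"
      using ogd t unfolding ogd_def by blast
    then show ?thesis
      using gradient_step_contracts[OF scs[OF t] \<open>0 < \<mu>\<close> \<open>0 < L\<close> \<open>0 < \<kappa>\<close> min[OF t] \<eta>
          less_imp_le[OF rho(1)], of "x (t - 1)"] that(2)
      by (simp add: dist_norm norm_minus_commute)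
  qed
  have near: "norm (xhat t - xstar t) \<le> Emax" if "t \<in> {1..T}" for t
    using est[OF that] E_le[OF that] unfolding E_def by linarith
  have move: "norm (xstar (t + 1) - xstar t) \<le> max_step T xstar" if "t \<in> {1..T - 1}" for t
    unfolding max_step_def using that by (intro Max_ge) auto
  have v: "0 \<le> max_step T xstar" unfolding max_step_def by (intro Max_ge) auto
  have room: "2 * Emax + max_step T xstar \<le> (1 - ?\<rho>) * \<kappa>"
    using \<kappa>(2) rho unfolding Emax_def by (simp add: field_simps)
  have in_ball: "norm (x (t - 1) - xhat t) \<le> \<kappa>" if "t \<in> {1..T}" for t
    by (rule ogd_stays_in_balls[where T = T and x = x and c = xhat and u = xstar and E = Emax
          and v = "max_step T xstar" and \<rho> = ?\<rho>, OF contract near move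
          init[folded Emax_def] v less_imp_le[OF rho(1)] room less_imp_le[OF \<kappa>(1)] that])
  have err: "norm (x t - xstar t) \<le> ?\<rho> * norm (x (t - 1) - xstar t) + 2 * E t"
    if t: "t \<in> {1..T}" for t
  proof -
    have est': "norm (xhat t - xstar t) \<le> E t" using est[OF t] unfolding E_def .
    have "norm (x t - xstar t) \<le> norm (x t - xhat t) + norm (xhat t - xstar t)"
      using norm_triangle_ineq[of "x t - xhat t" "xhat t - xstar t"] by simp
    also have "\<dots> \<le> ?\<rho> * norm (x (t - 1) - xhat t) + E t"
      by (intro add_mono contract in_ball t est')
    finally have "norm (x t - xstar t) \<le> ?\<rho> * norm (x (t - 1) - xhat t) + E t" .
    moreover have "norm (x (t - 1) - xhat t) \<le> norm (x (t - 1) - xstar t) + norm (xhat t - xstar t)"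
      using norm_triangle_ineq4[of "x (t - 1) - xstar t" "xhat t - xstar t"] by simp
    then have "?\<rho> * norm (x (t - 1) - xhat t) \<le> ?\<rho> * (norm (x (t - 1) - xstar t) + E t)"
      using rho est' by (intro mult_left_mono) auto
    moreover have "?\<rho> * E t \<le> 1 * E t"
      using rho E_nonneg[OF t] by (intro mult_right_mono) auto
    ultimately show ?thesis by (simp add: algebra_simps)
  qed
  have "(1 - ?\<rho>) * (\<Sum>t=1..T. norm (x t - xstar t)) + ?\<rho> * norm (x T - xstar T)
      \<le> Emax + (\<Sum>t=1..T - 1. norm (xstar (t + 1) - xstar t)) + (\<Sum>t=1..T. 2 * E t)"
  proof (rule sum_le_of_linear_recursion[OF \<open>T \<ge> 1\<close>])
    have "?\<rho> * norm (x 0 - xstar 1) \<le> 1 * norm (x 0 - xstar 1)"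
      using rho by (intro mult_right_mono) auto
    then show "norm (x 1 - xstar 1) \<le> Emax + 2 * E 1"
      using err[of 1] \<open>T \<ge> 1\<close> init unfolding Emax_def by simp
  next
    fix t assume "t \<in> {1..T - 1}"
    then have t: "t + 1 \<in> {1..T}" by auto
    have "norm (x t - xstar (t + 1)) \<le> norm (x t - xstar t) + norm (xstar (t + 1) - xstar t)"
      using norm_triangle_ineq4[of "x t - xstar t" "xstar (t + 1) - xstar t"] by simp
    then have "?\<rho> * norm (x t - xstar (t + 1))
        \<le> ?\<rho> * (norm (x t - xstar t) + norm (xstar (t + 1) - xstar t))"
      using rho by (intro mult_left_mono) auto
    moreover have "?\<rho> * norm (xstar (t + 1) - xstar t) \<le> 1 * norm (xstar (t + 1) - xstar t)"
      using rho by (intro mult_right_mono) auto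
    ultimately show "norm (x (t + 1) - xstar (t + 1))
        \<le> ?\<rho> * norm (x t - xstar t) + norm (xstar (t + 1) - xstar t) + 2 * E (t + 1)"
      using err[OF t] by (simp add: algebra_simps)
  qed
  moreover have "0 \<le> ?\<rho> * norm (x T - xstar T)" using rho by simp
  ultimately show ?thesis
    using Emax_le unfolding CTTE_def path_length_def by (simp add: sum_distrib_left[symmetric] E_def)
qed

theorem theorem2:
  fixes a :: "nat \<Rightarrow> real^'n" and m :: nat and Region :: "(real^'n) set"
    and \<theta> c0 K1 K2 \<Lambda> \<delta> \<mu> L \<eta> :: real
  assumes "span ((\<lambda>i. a i - a 1) ` {2..m}) = UNIV"
    and "compact Region"
    and "0 < \<theta>" "\<theta> < 1" "0 < c0" "0 < K1" "0 < K2" "0 < \<Lambda>" "0 < \<delta>" "0 < \<mu>" "0 < L"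
    and "0 < \<eta>" "\<eta> \<le> 2 / (\<mu> + L)"
    and "0 < rho \<eta> \<mu> L" "rho \<eta> \<mu> L < 1"
  shows "\<exists>C>0. \<forall>T\<ge>1. \<forall>(xstar :: nat \<Rightarrow> real^'n) (\<sigma> :: nat \<Rightarrow> real)
      (M :: 'w measure) (w :: nat \<Rightarrow> nat \<Rightarrow> 'w \<Rightarrow> real).
    trajectory_conditions m a Region \<theta> c0 K1 K2 \<Lambda> \<delta> \<eta> \<mu> L T xstar \<sigma> \<longrightarrow>
    noise_model M m T \<sigma> w \<longrightarrow>
    (\<forall>\<omega>\<in>space M. \<forall>(f :: nat \<Rightarrow> real^'n \<Rightarrow> real) (xhat :: nat \<Rightarrow> real^'n) (x :: nat \<Rightarrow> real^'n).
      (\<forall>t\<in>{1..T}. noise_bounded m a \<theta> c0 (xstar t) (\<sigma> t) (\<lambda>i. w t i \<omega>)) \<longrightarrow>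
      (\<forall>t\<in>{1..T}. f t = toa_loss m a (toa_range a (xstar t) (\<lambda>i. w t i \<omega>))) \<longrightarrow>
      (\<forall>t\<in>{1..T}. least_squares_estimate m a (toa_range a (xstar t) (\<lambda>i. w t i \<omega>)) (xhat t)) \<longrightarrow>
      (\<forall>t\<in>{1..T}. strongly_convex_smooth_on
         (cball (xhat t) (kappa m c0 K1 K2 \<Lambda> \<delta> (sigma_max T \<sigma>))) (f t) \<mu> L) \<longrightarrow>
      norm (x 0 - xstar 1) \<le> err_bound m K1 K2 (sigma_max T \<sigma>) \<longrightarrow>
      ogd T \<eta> f x \<longrightarrow>
      CTTE T xstar x \<le> C * (1 + path_length T xstar + cum_noise_std T \<sigma> + cum_noise_var T \<sigma>))"
proof -
  define C where "C = (1 + 3 * K1 * sqrt (real m) + 3 * K2 * real m) / (1 - rho \<eta> \<mu> L)"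
  have "0 \<le> 3 * K1 * sqrt (real m)" "0 \<le> 3 * K2 * real m"
    using \<open>0 < K1\<close> \<open>0 < K2\<close> by simp_all
  then have "C > 0"
    unfolding C_def using \<open>rho \<eta> \<mu> L < 1\<close> by simp
  have bound: "CTTE T xstar x
      \<le> C * (1 + path_length T xstar + cum_noise_std T \<sigma> + cum_noise_var T \<sigma>)"
    if "T \<ge> 1"
      and traj: "trajectory_conditions m a Region \<theta> c0 K1 K2 \<Lambda> \<delta> \<eta> \<mu> L T xstar \<sigma>"
      and noise: "\<forall>t\<in>{1..T}. noise_bounded m a \<theta> c0 (xstar t) (\<sigma> t) (W t)"
      and f: "\<forall>t\<in>{1..T}. f t = toa_loss m a (toa_range a (xstar t) (W t))"
      and lse: "\<forall>t\<in>{1..T}. least_squares_estimate m a (toa_range a (xstar t) (W t)) (xhat t)"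
      and scs: "\<forall>t\<in>{1..T}. strongly_convex_smooth_on
         (cball (xhat t) (kappa m c0 K1 K2 \<Lambda> \<delta> (sigma_max T \<sigma>))) (f t) \<mu> L"
      and init: "norm (x 0 - xstar 1) \<le> err_bound m K1 K2 (sigma_max T \<sigma>)"
      and ogd: "ogd T \<eta> f x"
    for T and xstar :: "nat \<Rightarrow> real^'n" and \<sigma> W f xhat x
  proof -
    have \<sigma>: "0 \<le> \<sigma> t" if "t \<in> {1..T}" for t
      using traj that unfolding trajectory_conditions_def by blast
    have est: "norm (xhat t - xstar t) \<le> err_bound m K1 K2 (\<sigma> t)" if "t \<in> {1..T}" for t
    proof -
      have "estimation_error_consts m a \<theta> c0 K1 K2 (xstar t)"
        using traj that unfolding trajectory_conditions_def by blast
      then show ?thesis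
        using \<sigma>[OF that] noise[rule_format, OF that] lse[rule_format, OF that]
        unfolding estimation_error_consts_def by blast
    qed
    have min: "f t (xhat t) \<le> f t y" if "t \<in> {1..T}" for t y
      using lse[rule_format, OF that] f[rule_format, OF that]
      unfolding least_squares_estimate_def is_arg_min_def by (simp add: not_less)
    let ?V = "path_length T xstar" and ?N1 = "cum_noise_std T \<sigma>" and ?N2 = "cum_noise_var T \<sigma>"
    have nonneg: "0 \<le> ?V" "0 \<le> ?N1" "0 \<le> ?N2"
      unfolding path_length_def cum_noise_std_def cum_noise_var_def
      by (auto intro!: sum_nonneg \<sigma>)
    define A where "A = 3 * K1 * sqrt (real m)"
    define B where "B = 3 * K2 * real m"
    have AB: "0 \<le> A" "0 \<le> B" unfolding A_def B_def using \<open>0 < K1\<close> \<open>0 < K2\<close> by auto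
    have "(1 - rho \<eta> \<mu> L) * CTTE T xstar x
        \<le> ?V + 3 * (\<Sum>t=1..T. err_bound m K1 K2 (\<sigma> t))"
    proof (rule ctte_bound[where f = f and xhat = xhat and \<eta> = \<eta>
          and \<kappa> = "kappa m c0 K1 K2 \<Lambda> \<delta> (sigma_max T \<sigma>)"])
      show "kappa m c0 K1 K2 \<Lambda> \<delta> (sigma_max T \<sigma>) > 0"
        "kappa m c0 K1 K2 \<Lambda> \<delta> (sigma_max T \<sigma>) \<ge>
          (2 * err_bound m K1 K2 (sigma_max T \<sigma>) + max_step T xstar) / (1 - rho \<eta> \<mu> L)"
        using traj unfolding trajectory_conditions_def by blast+
    qed (fact \<open>T \<ge> 1\<close> assms init ogd | erule \<sigma> est min | use scs in blast)+
    also have "\<dots> = ?V + A * ?N1 + B * ?N2"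
      unfolding sum_err_bound A_def B_def by (simp add: algebra_simps)
    also have "\<dots> \<le> (1 + A + B) * (1 + ?V + ?N1 + ?N2)"
    proof -
      have "A * ?N1 \<le> (1 + A + B) * ?N1" "B * ?N2 \<le> (1 + A + B) * ?N2" "1 * ?V \<le> (1 + A + B) * ?V"
        using nonneg AB by (intro mult_right_mono; simp)+
      then show ?thesis using AB unfolding distrib_left by simp
    qed
    finally show ?thesis
      using \<open>rho \<eta> \<mu> L < 1\<close> unfolding C_def A_def B_def by (simp add: field_simps)
  qed
  show ?thesis
    by (intro exI[of _ C] conjI \<open>C > 0\<close> allI impI ballI) (rule bound; assumption)
qed

end
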